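(* Let $G$ be a connected graph and let $N$ be a positive integer such that $P_{\ell}^u (G, k) = P^u (G, k)$ for all integers $k \geq N$. Then, for every positive integer $m$, $P_{\ell}^u (m G, k) = P^u (m G, k)$ for all integers $k \geq N$ (with the same $N$).
   Context: All graphs are nonempty, finite and simple. For a graph $G$ and a positive integer $m$, $mG$ denotes the disjoint union of $m$ copies of $G$. A proper $k$-coloring of a graph $G$ is a map $f : V(G) \to \{1, \ldots, k\}$ such that adjacent vertices receive different values. Two colorings $f, g$ of $G$ are equivalent up to labeling if there is an automorphism $\pi$ of $G$ such that $f(v) = g(\pi(v))$ for all $v \in V(G)$. $P^u(G,k)$ denotes the number of equivalence classes of proper $k$-colorings of $G$ under this relation. A $k$-assignment $L$ for $G$ assigns to each vertex $v \in V(G)$ a set $L(v)$ of exactly $k$ available colors (there is no restriction on which colors are used, and different vertices may have different lists). A proper $L$-coloring of $G$ is a map $f$ on $V(G)$ with $f(v) \in L(v)$ for every $v \in V(G)$ and $f(u) \ne f(v)$ whenever $u, v$ are adjacent. $P^u(G, L)$ denotes the number of equivalence classes of proper $L$-colorings of $G$, where two proper $L$-colorings $f, g$ are equivalent if $f = g \circ \pi$ for some automorphism $\pi$ of $G$. The unlabeled list color function $P^u_{\ell}(G, k)$ is the minimum of $P^u(G, L)$ over all $k$-assignments $L$ for $G$. *)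

theory Defs
  imports "Graph_Theory.Graph_Theory" "HOL-Library.FuncSet"
begin

text \<open>
  A finite simple graph is a \<^locale>\<open>pair_graph\<close>: a finite vertex set together with a symmetric
  irreflexive arc relation, so each edge is represented by its two opposite arcs. Note that
  \<^const>\<open>connected\<close> includes nonemptiness of the vertex set.
\<close>

definition disjoint_copies :: "nat \<Rightarrow> 'a pair_pre_digraph \<Rightarrow> (nat \<times> 'a) pair_pre_digraph" where
  "disjoint_copies m G =
    \<lparr> pverts = {..<m} \<times> pverts G,
      parcs = {((i, u), (i, v)) | i u v. i < m \<and> (u, v) \<in> parcs G} \<rparr>"

definition graph_automorphism :: "'a pair_pre_digraph \<Rightarrow> ('a \<Rightarrow> 'a) \<Rightarrow> bool" where
  "graph_automorphism G \<pi> \<longleftrightarrow>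
    bij_betw \<pi> (pverts G) (pverts G) \<and>
    (\<forall>u\<in>pverts G. \<forall>v\<in>pverts G. (u, v) \<in> parcs G \<longleftrightarrow> (\<pi> u, \<pi> v) \<in> parcs G)"

text \<open>
  Colors are natural numbers; this loses nothing, since only finitely many colors occur in
  the lists of a finite graph. Colorings are functions on the vertex set only, hence the
  extensional function space.
\<close>

definition list_colorings :: "'a pair_pre_digraph \<Rightarrow> ('a \<Rightarrow> nat set) \<Rightarrow> ('a \<Rightarrow> nat) set" where
  "list_colorings G L =
    {f \<in> (\<Pi>\<^sub>E v\<in>pverts G. L v). \<forall>(u, v)\<in>parcs G. f u \<noteq> f v}"

definition coloring_equiv ::
    "'a pair_pre_digraph \<Rightarrow> ('a \<Rightarrow> nat set) \<Rightarrow> (('a \<Rightarrow> nat) \<times> ('a \<Rightarrow> nat)) set" where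
  "coloring_equiv G L =
    {(f, g). f \<in> list_colorings G L \<and> g \<in> list_colorings G L \<and>
       (\<exists>\<pi>. graph_automorphism G \<pi> \<and> (\<forall>v\<in>pverts G. f v = g (\<pi> v)))}"

definition unlabeled_list_count :: "'a pair_pre_digraph \<Rightarrow> ('a \<Rightarrow> nat set) \<Rightarrow> nat" where
  "unlabeled_list_count G L = card (list_colorings G L // coloring_equiv G L)"

text \<open>A proper k-coloring is a proper coloring from the constant lists \<open>{1..k}\<close>.\<close>

definition unlabeled_chromatic :: "'a pair_pre_digraph \<Rightarrow> nat \<Rightarrow> nat" where
  "unlabeled_chromatic G k = unlabeled_list_count G (\<lambda>_. {1..k})"

definition k_assignment :: "'a pair_pre_digraph \<Rightarrow> nat \<Rightarrow> ('a \<Rightarrow> nat set) \<Rightarrow> bool" where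
  "k_assignment G k L \<longleftrightarrow> (\<forall>v\<in>pverts G. finite (L v) \<and> card (L v) = k)"

definition unlabeled_list_color_function :: "'a pair_pre_digraph \<Rightarrow> nat \<Rightarrow> nat" where
  "unlabeled_list_color_function G k =
    (LEAST n. \<exists>L. k_assignment G k L \<and> n = unlabeled_list_count G L)"

lemma k_assignment_const: "k_assignment G k (\<lambda>_. {1..k})"
  by (simp add: k_assignment_def)

lemma unlabeled_list_color_function_attained:
  "\<exists>L. k_assignment G k L \<and> unlabeled_list_color_function G k = unlabeled_list_count G L"
  unfolding unlabeled_list_color_function_def
  by (rule LeastI_ex) (use k_assignment_const in blast)

lemma pair_graph_disjoint_copies:
  assumes "pair_graph G"
  shows "pair_graph (disjoint_copies m G)"
proof -
  interpret pair_graph G by fact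
  let ?H = "disjoint_copies m G"
  have "parcs ?H \<subseteq> pverts ?H \<times> pverts ?H"
    by (auto simp: disjoint_copies_def dest: wellformed')
  moreover have "finite (pverts ?H)"
    by (simp add: disjoint_copies_def)
  ultimately have "finite (parcs ?H)"
    by (meson finite_SigmaI finite_subset)
  then show ?thesis
    by unfold_locales
      (auto simp: disjoint_copies_def symmetric_def sym_def
        dest: wellformed' no_loops' arcs_symmetric)
qed

lemma equiv_coloring_equiv: "equiv (list_colorings G L) (coloring_equiv G L)"
proof (rule equivI)
  show "coloring_equiv G L \<subseteq> list_colorings G L \<times> list_colorings G L"
    by (auto simp: coloring_equiv_def)
  have "graph_automorphism G id"
    by (simp add: graph_automorphism_def)
  then show "refl_on (list_colorings G L) (coloring_equiv G L)"
    by (fastforce simp: refl_on_def coloring_equiv_def)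
  show "sym (coloring_equiv G L)"
  proof (rule symI)
    fix f g assume "(f, g) \<in> coloring_equiv G L"
    then obtain p where fg: "f \<in> list_colorings G L" "g \<in> list_colorings G L"
      and p: "graph_automorphism G p" "\<forall>v\<in>pverts G. f v = g (p v)"
      by (auto simp: coloring_equiv_def)
    let ?q = "inv_into (pverts G) p"
    have b: "bij_betw p (pverts G) (pverts G)"
      using p by (simp add: graph_automorphism_def)
    have q: "bij_betw ?q (pverts G) (pverts G)"
      by (rule bij_betw_inv_into[OF b])
    have mem: "?q v \<in> pverts G" and inv: "p (?q v) = v" if "v \<in> pverts G" for v
      using that q b by (auto simp: bij_betw_inv_into_right dest: bij_betwE)
    have "graph_automorphism G ?q"
      using q p(1) mem inv by (auto simp: graph_automorphism_def)
    moreover have "\<forall>v\<in>pverts G. g v = f (?q v)"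
      using p(2) mem inv by auto
    ultimately show "(g, f) \<in> coloring_equiv G L"
      using fg by (auto simp: coloring_equiv_def)
  qed
  show "trans (coloring_equiv G L)"
  proof (rule transI)
    fix f g h assume "(f, g) \<in> coloring_equiv G L" "(g, h) \<in> coloring_equiv G L"
    then obtain p q where fh: "f \<in> list_colorings G L" "h \<in> list_colorings G L"
      and p: "graph_automorphism G p" "\<forall>v\<in>pverts G. f v = g (p v)"
      and q: "graph_automorphism G q" "\<forall>v\<in>pverts G. g v = h (q v)"
      by (auto simp: coloring_equiv_def)
    have mem: "p v \<in> pverts G" if "v \<in> pverts G" for v
      using that p(1) by (auto simp: graph_automorphism_def dest: bij_betwE)
    have "graph_automorphism G (q \<circ> p)"
      unfolding graph_automorphism_def
    proof (intro conjI ballI)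
      show "bij_betw (q \<circ> p) (pverts G) (pverts G)"
        using p(1) q(1) by (auto simp: graph_automorphism_def intro: bij_betw_trans)
      fix u v assume uv: "u \<in> pverts G" "v \<in> pverts G"
      have "(u, v) \<in> parcs G \<longleftrightarrow> (p u, p v) \<in> parcs G"
        using p(1) uv by (simp add: graph_automorphism_def)
      also have "\<dots> \<longleftrightarrow> (q (p u), q (p v)) \<in> parcs G"
        using q(1) mem[OF uv(1)] mem[OF uv(2)] by (simp add: graph_automorphism_def)
      finally show "(u, v) \<in> parcs G \<longleftrightarrow> ((q \<circ> p) u, (q \<circ> p) v) \<in> parcs G"
        by simp
    qed
    moreover have "\<forall>v\<in>pverts G. f v = h ((q \<circ> p) v)"
      using p(2) q(2) mem by simp
    ultimately show "(f, h) \<in> coloring_equiv G L"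
      using fh unfolding coloring_equiv_def by blast
  qed
qed

end

theory Submission
  imports Defs "HOL-Combinatorics.Permutations"
begin

text \<open>
  An automorphism of \<open>mG\<close> permutes the copies of the connected graph \<open>G\<close> and acts by an
  automorphism of \<open>G\<close> on each of them. Hence a coloring of \<open>mG\<close> is determined up to equivalence by
  the multiset of the \<open>m\<close> equivalence classes of its restrictions to the copies
  (\<open>unlabeled_list_count_disjoint_copies\<close>). If \<open>X i\<close> is the set of classes that the lists permit on
  copy \<open>i\<close>, then what is counted are the multisets that arise by choosing one element from each of
  \<open>X 0, \<dots>, X (m - 1)\<close>.

  For the constant lists \<open>{1..k}\<close> all these sets are the same set, of size
  \<open>x = unlabeled_chromatic G k\<close>, and every multiset of size \<open>m\<close> over it arises; there are
  \<open>(x + m - 1) choose m\<close> of them. For an arbitrary assignment the hypothesis on \<open>G\<close> says that each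
  \<open>X i\<close> has at least \<open>x\<close> elements, and it remains to see that \<open>m\<close> sets of size at least \<open>x\<close> yield
  at least as many multisets as \<open>m\<close> equal sets of size \<open>x\<close> do (\<open>card_transversal_msets_ge\<close>). This is
  an induction following Pascal's rule.
\<close>

section \<open>Multisets of representatives\<close>

definition transversal_msets :: "nat \<Rightarrow> (nat \<Rightarrow> 'b set) \<Rightarrow> 'b multiset set" where
  "transversal_msets m X = {image_mset c (mset_set {..<m}) | c. \<forall>i<m. c i \<in> X i}"

lemma transversal_msetsI:
  "(\<And>i. i < m \<Longrightarrow> c i \<in> X i) \<Longrightarrow> image_mset c (mset_set {..<m}) \<in> transversal_msets m X"
  by (auto simp: transversal_msets_def)

lemma transversal_msetsE:
  assumes "M \<in> transversal_msets m X"
  obtains c where "M = image_mset c (mset_set {..<m})" "\<And>i. i < m \<Longrightarrow> c i \<in> X i"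
  using assms by (auto simp: transversal_msets_def)

lemma transversal_msets_0 [simp]: "transversal_msets 0 X = {{#}}"
  by (simp add: transversal_msets_def)

lemma transversal_msets_subset:
  "transversal_msets m X \<subseteq> multisets_of_size (\<Union>i<m. X i) m"
  by (force simp: transversal_msets_def multisets_of_size_def)

lemma finite_transversal_msets:
  assumes "\<And>i. i < m \<Longrightarrow> finite (X i)"
  shows "finite (transversal_msets m X)"
  by (rule finite_subset[OF transversal_msets_subset])
    (use assms in \<open>auto intro!: finite_multisets_of_size\<close>)

lemma transversal_msets_mono:
  assumes "\<And>i. i < m \<Longrightarrow> X i \<subseteq> Y i"
  shows "transversal_msets m X \<subseteq> transversal_msets m Y"
  using assms by (fastforce simp: transversal_msets_def)

lemma add_mset_transversal_msets:
  assumes "a \<in> X m" "M \<in> transversal_msets m X"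
  shows "add_mset a M \<in> transversal_msets (Suc m) X"
proof -
  from assms(2) obtain c where c: "M = image_mset c (mset_set {..<m})" "\<And>i. i < m \<Longrightarrow> c i \<in> X i"
    by (rule transversal_msetsE) blast
  have "image_mset (c(m := a)) (mset_set {..<m}) = M"
    unfolding c(1) by (rule image_mset_cong) auto
  then have "add_mset a M = image_mset (c(m := a)) (mset_set {..<Suc m})"
    by (simp add: lessThan_Suc)
  moreover have "image_mset (c(m := a)) (mset_set {..<Suc m}) \<in> transversal_msets (Suc m) X"
    by (rule transversal_msetsI) (use assms(1) c(2) in \<open>auto simp: less_Suc_eq\<close>)
  ultimately show ?thesis
    by simp
qed

text \<open>
  Fix an element \<open>a\<close> of the last set. Representatives of the other sets, together with \<open>a\<close>, give
  multisets that contain \<open>a\<close>, and removing \<open>a\<close> from every set gives multisets that do not contain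
  it. The two resulting lower bounds are the two summands of Pascal's rule.
\<close>

lemma card_transversal_msets_ge:
  assumes "\<And>i. i < m \<Longrightarrow> finite (X i)" "\<And>i. i < m \<Longrightarrow> n \<le> card (X i)"
  shows "(n + m - 1) choose m \<le> card (transversal_msets m X)"
  using assms
proof (induction "n + m" arbitrary: n m X rule: less_induct)
  case less
  note fin = less.prems(1) and card = less.prems(2)
  show ?case
  proof (cases m)
    case 0
    then show ?thesis by simp
  next
    case m: (Suc m')
    show ?thesis
    proof (cases n)
      case 0
      then show ?thesis by (simp add: m binomial_eq_0)
    next
      case n: (Suc n')
      have "card (X m') > 0"
        using card[of m'] m n by simp
      then obtain a where a: "a \<in> X m'"
        by (metis card.empty ex_in_conv less_irrefl)
      define Y where "Y = (\<lambda>i. X i - {a})"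
      let ?A = "add_mset a ` transversal_msets m' X" and ?B = "transversal_msets m Y"
      have "(n + m' - 1) choose m' \<le> card (transversal_msets m' X)"
        by (rule less.hyps) (use fin card m in auto)
      then have A: "(n + m' - 1) choose m' \<le> card ?A"
        by (simp add: card_image inj_on_def)
      have B: "(n' + m - 1) choose m \<le> card ?B"
      proof (rule less.hyps)
        fix i assume i: "i < m"
        show "finite (Y i)"
          using fin[OF i] by (simp add: Y_def)
        have "card (X i) \<le> Suc (card (Y i))"
          unfolding Y_def by (simp add: card_Diff_singleton_if) linarith
        then show "n' \<le> card (Y i)"
          using card[OF i] n by simp
      qed (simp add: n)
      have "a \<notin># M" if "M \<in> ?B" for M
        using that by (auto simp: transversal_msets_def Y_def)
      then have disj: "?A \<inter> ?B = {}"
        by fastforce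
      have sub: "?A \<union> ?B \<subseteq> transversal_msets m X"
        using add_mset_transversal_msets[of a X m'] a transversal_msets_mono[of m Y X]
        by (auto simp: m Y_def)
      have fin': "finite (transversal_msets m X)"
        by (rule finite_transversal_msets) (rule fin)
      have "(n + m - 1) choose m = ((n + m' - 1) choose m') + ((n' + m - 1) choose m)"
        by (simp add: m n)
      also have "\<dots> \<le> card ?A + card ?B"
        using A B by simp
      also have "\<dots> = card (?A \<union> ?B)"
        by (rule card_Un_disjoint[symmetric]) (use disj sub fin' in \<open>auto intro: finite_subset\<close>)
      also have "\<dots> \<le> card (transversal_msets m X)"
        by (rule card_mono[OF fin' sub])
      finally show ?thesis .
    qed
  qed
qed

lemma card_transversal_msets_const_le:
  assumes "finite A"
  shows "card (transversal_msets m (\<lambda>_. A)) \<le> (card A + m - 1) choose m"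
proof -
  have "transversal_msets m (\<lambda>_. A) \<subseteq> multisets_of_size A m"
    by (auto simp: transversal_msets_def multisets_of_size_def)
  then have "card (transversal_msets m (\<lambda>_. A)) \<le> card (multisets_of_size A m)"
    by (rule card_mono[OF finite_multisets_of_size[OF assms]])
  then show ?thesis
    by (simp add: card_multisets_of_size[OF assms])
qed

section \<open>Classes of colorings\<close>

text \<open>
  The classes that occur for two different assignments can only be compared if they are formed in a
  common set. Letting every vertex use every color provides such a set.
\<close>

definition coloring_class :: "'a pair_pre_digraph \<Rightarrow> ('a \<Rightarrow> nat) \<Rightarrow> ('a \<Rightarrow> nat) set" where
  "coloring_class G f = coloring_equiv G (\<lambda>_. UNIV) `` {f}"

lemma list_colorings_subset_UNIV: "list_colorings G L \<subseteq> list_colorings G (\<lambda>_. UNIV)"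
  by (auto simp: list_colorings_def PiE_iff)

lemma coloring_class_eq_iff:
  assumes "f \<in> list_colorings G L" "g \<in> list_colorings G L'"
  shows "coloring_class G f = coloring_class G g \<longleftrightarrow>
    (\<exists>\<pi>. graph_automorphism G \<pi> \<and> (\<forall>v\<in>pverts G. f v = g (\<pi> v)))"
proof -
  have "f \<in> list_colorings G (\<lambda>_. UNIV)" "g \<in> list_colorings G (\<lambda>_. UNIV)"
    using assms list_colorings_subset_UNIV by blast+
  then show ?thesis
    unfolding coloring_class_def
    by (subst eq_equiv_class_iff[OF equiv_coloring_equiv]) (auto simp: coloring_equiv_def)
qed

lemma card_image_eq_if_same_fibres:
  assumes "\<And>x y. x \<in> A \<Longrightarrow> y \<in> A \<Longrightarrow> s x = s y \<longleftrightarrow> t x = t y"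
  shows "card (s ` A) = card (t ` A)"
proof -
  let ?h = "\<lambda>z. t (inv_into A s z)"
  have h: "?h (s x) = t x" if "x \<in> A" for x
    using that assms by (metis f_inv_into_f imageI inv_into_into)
  have "inj_on ?h (s ` A)"
    by (rule inj_onI) (use assms h in auto)
  moreover have "?h ` s ` A = t ` A"
    using h by (auto simp: image_iff)
  ultimately show ?thesis
    by (metis card_image)
qed

text \<open>
  The invariant \<open>t\<close> is left open because two are used: for \<open>G\<close> the class of a coloring, and for
  \<open>mG\<close> the multiset of the classes on the copies.
\<close>

lemma unlabeled_list_count_eq_card_invariant:
  assumes "\<And>f g. f \<in> list_colorings G L \<Longrightarrow> g \<in> list_colorings G L \<Longrightarrow>
    t f = t g \<longleftrightarrow> (\<exists>\<pi>. graph_automorphism G \<pi> \<and> (\<forall>v\<in>pverts G. f v = g (\<pi> v)))"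
  shows "unlabeled_list_count G L = card (t ` list_colorings G L)"
proof -
  have "list_colorings G L // coloring_equiv G L =
      (\<lambda>f. coloring_equiv G L `` {f}) ` list_colorings G L"
    by (auto simp: quotient_def)
  moreover have "card ((\<lambda>f. coloring_equiv G L `` {f}) ` list_colorings G L) =
      card (t ` list_colorings G L)"
  proof (rule card_image_eq_if_same_fibres)
    fix f g assume fg: "f \<in> list_colorings G L" "g \<in> list_colorings G L"
    show "coloring_equiv G L `` {f} = coloring_equiv G L `` {g} \<longleftrightarrow> t f = t g"
      unfolding eq_equiv_class_iff[OF equiv_coloring_equiv fg] assms[OF fg]
      using fg by (auto simp: coloring_equiv_def)
  qed
  ultimately show ?thesis
    by (simp add: unlabeled_list_count_def)
qed

lemma unlabeled_list_count_eq_card_classes: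
  "unlabeled_list_count G L = card (coloring_class G ` list_colorings G L)"
  by (rule unlabeled_list_count_eq_card_invariant) (rule coloring_class_eq_iff)

lemma finite_list_colorings:
  assumes "finite (pverts G)" "k_assignment G k L"
  shows "finite (list_colorings G L)"
  by (rule finite_subset[of _ "\<Pi>\<^sub>E v\<in>pverts G. L v"])
    (use assms in \<open>auto simp: list_colorings_def k_assignment_def intro!: finite_PiE\<close>)

section \<open>Automorphisms of disjoint copies\<close>

lemma pverts_disjoint_copies: "(i, v) \<in> pverts (disjoint_copies m G) \<longleftrightarrow> i < m \<and> v \<in> pverts G"
  by (simp add: disjoint_copies_def)

lemma parcs_disjoint_copies:
  "((i, u), (j, v)) \<in> parcs (disjoint_copies m G) \<longleftrightarrow> i < m \<and> i = j \<and> (u, v) \<in> parcs G"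
  by (auto simp: disjoint_copies_def)

lemma graph_automorphism_disjoint_copiesI:
  assumes \<sigma>: "bij_betw \<sigma> {..<m} {..<m}" and \<pi>: "\<And>i. i < m \<Longrightarrow> graph_automorphism G (\<pi> i)"
  shows "graph_automorphism (disjoint_copies m G) (\<lambda>(i, v). (\<sigma> i, \<pi> i v))"
proof -
  let ?P = "\<lambda>(i, v). (\<sigma> i, \<pi> i v)"
  have \<sigma>_inj: "\<sigma> i = \<sigma> j \<longleftrightarrow> i = j" if "i < m" "j < m" for i j
    using \<sigma> that by (auto simp: bij_betw_def inj_on_def)
  have \<sigma>_less: "\<sigma> i < m" if "i < m" for i
    using \<sigma> that by (auto dest: bij_betwE)
  have \<pi>_bij: "bij_betw (\<pi> i) (pverts G) (pverts G)" if "i < m" for i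
    using \<pi>[OF that] by (simp add: graph_automorphism_def)
  have "inj_on ?P ({..<m} \<times> pverts G)"
  proof (rule inj_onI, clarsimp)
    fix i u j v
    assume *: "i < m" "u \<in> pverts G" "j < m" "v \<in> pverts G" "\<sigma> i = \<sigma> j" "\<pi> i u = \<pi> j v"
    then have "i = j" using \<sigma>_inj by blast
    then show "i = j \<and> u = v"
      using * \<pi>_bij[of i] by (auto simp: bij_betw_def inj_on_def)
  qed
  moreover have "?P ` ({..<m} \<times> pverts G) = {..<m} \<times> pverts G"
  proof
    show "?P ` ({..<m} \<times> pverts G) \<subseteq> {..<m} \<times> pverts G"
      using \<sigma>_less \<pi>_bij by (auto dest: bij_betwE)
    show "{..<m} \<times> pverts G \<subseteq> ?P ` ({..<m} \<times> pverts G)"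
    proof clarsimp
      fix j v assume j: "j < m" and v: "v \<in> pverts G"
      obtain i where i: "i < m" "\<sigma> i = j"
        using bij_betw_imp_surj_on[OF \<sigma>] j by (metis imageE lessThan_iff)
      obtain u where u: "u \<in> pverts G" "\<pi> i u = v"
        using bij_betw_imp_surj_on[OF \<pi>_bij[OF i(1)]] v by (metis imageE)
      have "(j, v) = ?P (i, u)"
        using i(2) u(2) by simp
      then show "(j, v) \<in> ?P ` ({..<m} \<times> pverts G)"
        using i(1) u(1) by blast
    qed
  qed
  ultimately have "bij_betw ?P ({..<m} \<times> pverts G) ({..<m} \<times> pverts G)"
    by (simp add: bij_betw_def)
  then show ?thesis
    using \<pi> \<sigma>_less \<sigma>_inj
    by (auto simp: graph_automorphism_def pverts_disjoint_copies parcs_disjoint_copies)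
      (auto simp: disjoint_copies_def)
qed

text \<open>
  A path in \<open>G\<close> lies in each copy, and its image under an automorphism cannot leave a copy; so
  connectedness makes the copy that receives a vertex depend only on the copy it comes from.
  Injectivity makes the map within the copies bijective on the finite vertex set. If two copies were
  sent to the same one, they would both cover it, against injectivity.
\<close>

lemma graph_automorphism_disjoint_copiesE:
  assumes G: "pair_graph G" and conn: "connected (with_proj G)"
    and P: "graph_automorphism (disjoint_copies m G) P"
  obtains \<sigma> \<pi> where "bij_betw \<sigma> {..<m} {..<m}" "\<And>i. i < m \<Longrightarrow> graph_automorphism G (\<pi> i)"
    "\<And>i v. i < m \<Longrightarrow> v \<in> pverts G \<Longrightarrow> P (i, v) = (\<sigma> i, \<pi> i v)"
proof -
  interpret pair_graph G by fact
  have sc: "strongly_connected (with_proj G)"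
    by (rule symmetric_connected_imp_strongly_connected[OF _ conn]) (rule sym_arcs)
  then obtain r where r: "r \<in> pverts G"
    by (auto simp: strongly_connected_def)
  have reach: "r \<rightarrow>\<^sup>*\<^bsub>with_proj G\<^esub> v" if "v \<in> pverts G" for v
    using sc r that by (auto simp: strongly_connected_def)
  define \<sigma> where "\<sigma> i = fst (P (i, r))" for i
  define \<pi> where "\<pi> i v = snd (P (i, v))" for i v
  have P_bij: "bij_betw P ({..<m} \<times> pverts G) ({..<m} \<times> pverts G)"
    using P by (simp add: graph_automorphism_def disjoint_copies_def)
  have P_arc: "(P (i, u), P (i, v)) \<in> parcs (disjoint_copies m G) \<longleftrightarrow> (u, v) \<in> parcs G"
    if "i < m" "u \<in> pverts G" "v \<in> pverts G" for i u v
    using P that unfolding graph_automorphism_def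
    by (metis pverts_disjoint_copies parcs_disjoint_copies)
  have P_mem: "P (i, v) \<in> {..<m} \<times> pverts G" if "i < m" "v \<in> pverts G" for i v
    using P_bij that by (auto dest: bij_betwE)
  have fst_P: "fst (P (i, v)) = \<sigma> i" if i: "i < m" and v: "v \<in> pverts G" for i v
    using reach[OF v]
  proof (induction rule: reachable_induct)
    case base
    then show ?case by (simp add: \<sigma>_def)
  next
    case (step x y)
    then have xy: "(x, y) \<in> parcs G"
      by simp
    then have "(P (i, x), P (i, y)) \<in> parcs (disjoint_copies m G)"
      using P_arc[OF i] wellformed'[OF xy] by auto
    then have "fst (P (i, x)) = fst (P (i, y))"
      by (auto simp: disjoint_copies_def)
    then show ?case
      using step.IH by simp
  qed
  have P_eq: "P (i, v) = (\<sigma> i, \<pi> i v)" if "i < m" "v \<in> pverts G" for i v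
    using fst_P[OF that] by (simp add: \<pi>_def prod_eq_iff)
  have P_inj: "i = j \<and> u = v"
    if "P (i, u) = P (j, v)" "i < m" "j < m" "u \<in> pverts G" "v \<in> pverts G" for i j u v
    using bij_betw_imp_inj_on[OF P_bij] that by (auto dest: inj_onD)
  have \<sigma>_less: "\<sigma> i < m" if "i < m" for i
    using P_mem[OF that r] P_eq[OF that r] by simp
  have \<pi>_bij: "bij_betw (\<pi> i) (pverts G) (pverts G)" if i: "i < m" for i
  proof -
    have "inj_on (\<pi> i) (pverts G)"
      by (rule inj_onI) (use P_inj[OF _ i i] P_eq[OF i] in auto)
    moreover have "\<pi> i ` pverts G \<subseteq> pverts G"
      using P_mem[OF i] P_eq[OF i] by auto
    ultimately show ?thesis
      by (simp add: bij_betw_def endo_inj_surj)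
  qed
  have "inj_on \<sigma> {..<m}"
  proof (rule inj_onI)
    fix i j assume "i \<in> {..<m}" "j \<in> {..<m}" and eq: "\<sigma> i = \<sigma> j"
    then have ij: "i < m" "j < m" by auto
    have "\<pi> i r \<in> pverts G"
      using \<pi>_bij[OF ij(1)] r by (auto dest: bij_betwE)
    then obtain v where v: "v \<in> pverts G" "\<pi> j v = \<pi> i r"
      using bij_betw_imp_surj_on[OF \<pi>_bij[OF ij(2)]] by (metis imageE)
    have "P (i, r) = P (j, v)"
      using P_eq[OF ij(1) r] P_eq[OF ij(2) v(1)] eq v(2) by simp
    then show "i = j"
      using P_inj ij r v(1) by blast
  qed
  moreover have "\<sigma> ` {..<m} \<subseteq> {..<m}"
    using \<sigma>_less by auto
  ultimately have "bij_betw \<sigma> {..<m} {..<m}"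
    by (simp add: bij_betw_def endo_inj_surj)
  moreover have "graph_automorphism G (\<pi> i)" if i: "i < m" for i
    unfolding graph_automorphism_def
  proof (intro conjI ballI)
    show "bij_betw (\<pi> i) (pverts G) (pverts G)"
      by (rule \<pi>_bij[OF i])
    fix u v assume uv: "u \<in> pverts G" "v \<in> pverts G"
    show "(u, v) \<in> parcs G \<longleftrightarrow> (\<pi> i u, \<pi> i v) \<in> parcs G"
      using P_arc[OF i uv] P_eq[OF i] uv \<sigma>_less[OF i] by (simp add: parcs_disjoint_copies)
  qed
  ultimately show thesis
    using P_eq by (rule that)
qed

section \<open>Unlabeled colorings of disjoint copies\<close>

definition copy_coloring ::
    "'a pair_pre_digraph \<Rightarrow> (nat \<times> 'a \<Rightarrow> nat) \<Rightarrow> nat \<Rightarrow> 'a \<Rightarrow> nat" where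
  "copy_coloring G f i = (\<lambda>v\<in>pverts G. f (i, v))"

lemma copy_coloring_apply [simp]: "v \<in> pverts G \<Longrightarrow> copy_coloring G f i v = f (i, v)"
  by (simp add: copy_coloring_def)

lemma copy_coloring_mem:
  assumes "pair_graph G" "f \<in> list_colorings (disjoint_copies m G) L" "i < m"
  shows "copy_coloring G f i \<in> list_colorings G (\<lambda>v. L (i, v))"
proof -
  interpret pair_graph G by fact
  have mem: "f (i, v) \<in> L (i, v)" if "v \<in> pverts G" for v
    using assms(2,3) that by (auto simp: list_colorings_def disjoint_copies_def PiE_iff)
  have neq: "f (i, u) \<noteq> f (i, v)" if "(u, v) \<in> parcs G" for u v
  proof -
    have "((i, u), (i, v)) \<in> parcs (disjoint_copies m G)"
      using that assms(3) by (simp add: parcs_disjoint_copies)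
    then show ?thesis
      using assms(2) by (auto simp: list_colorings_def)
  qed
  show ?thesis
    using mem neq wellformed' by (fastforce simp: list_colorings_def copy_coloring_def)
qed

lemma ex_copy_colorings:
  assumes "pair_graph G" "\<And>i. i < m \<Longrightarrow> h i \<in> list_colorings G (\<lambda>v. L (i, v))"
  obtains f where "f \<in> list_colorings (disjoint_copies m G) L"
    "\<And>i. i < m \<Longrightarrow> copy_coloring G f i = h i"
proof -
  interpret pair_graph G by fact
  define f where "f = (\<lambda>(i, v)\<in>pverts (disjoint_copies m G). h i v)"
  have f: "f (i, v) = h i v" if "i < m" "v \<in> pverts G" for i v
    using that by (simp add: f_def pverts_disjoint_copies)
  have "copy_coloring G f i = h i" if "i < m" for i
    using f[OF that] assms(2)[OF that]
    by (auto simp: copy_coloring_def list_colorings_def PiE_iff extensional_def fun_eq_iff)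
  moreover have "f \<in> list_colorings (disjoint_copies m G) L"
  proof -
    have "f \<in> (\<Pi>\<^sub>E p\<in>pverts (disjoint_copies m G). L p)"
      using assms(2) by (auto simp: f_def pverts_disjoint_copies list_colorings_def PiE_iff)
    moreover have "f p \<noteq> f q" if pq: "(p, q) \<in> parcs (disjoint_copies m G)" for p q
    proof -
      obtain i u v where *: "p = (i, u)" "q = (i, v)" "i < m" "(u, v) \<in> parcs G"
        using pq by (auto simp: disjoint_copies_def)
      then show ?thesis
        using f assms(2)[OF *(3)] wellformed'[OF *(4)] by (auto simp: list_colorings_def)
    qed
    ultimately show ?thesis
      by (auto simp: list_colorings_def)
  qed
  ultimately show thesis
    using that by blast
qed

definition class_mset ::
    "nat \<Rightarrow> 'a pair_pre_digraph \<Rightarrow> (nat \<times> 'a \<Rightarrow> nat) \<Rightarrow> ('a \<Rightarrow> nat) set multiset" where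
  "class_mset m G f = image_mset (\<lambda>i. coloring_class G (copy_coloring G f i)) (mset_set {..<m})"

text \<open>
  Equality of the multisets is a permutation of the copies that matches equal classes, and an
  automorphism of \<open>G\<close> for each matched pair; together these data are an automorphism of \<open>mG\<close>.
\<close>

lemma class_mset_eq_iff:
  assumes G: "pair_graph G" and conn: "connected (with_proj G)"
    and f: "f \<in> list_colorings (disjoint_copies m G) L"
    and g: "g \<in> list_colorings (disjoint_copies m G) L"
  shows "class_mset m G f = class_mset m G g \<longleftrightarrow>
    (\<exists>P. graph_automorphism (disjoint_copies m G) P \<and>
      (\<forall>p\<in>pverts (disjoint_copies m G). f p = g (P p)))" (is "_ \<longleftrightarrow> ?R")
proof
  note class_eq = coloring_class_eq_iff[OF copy_coloring_mem[OF G f] copy_coloring_mem[OF G g]]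
  let ?cf = "\<lambda>i. coloring_class G (copy_coloring G f i)"
  let ?cg = "\<lambda>i. coloring_class G (copy_coloring G g i)"
  {
    assume "class_mset m G f = class_mset m G g"
    then obtain \<sigma> where \<sigma>: "\<sigma> permutes {..<m}" and eq: "\<forall>i\<in>{..<m}. ?cf i = ?cg (\<sigma> i)"
      unfolding class_mset_def by (rule image_mset_eq_implies_permutes[OF finite_lessThan])
    have bij: "bij_betw \<sigma> {..<m} {..<m}"
      by (rule permutes_imp_bij[OF \<sigma>])
    have "\<exists>\<pi>. graph_automorphism G \<pi> \<and> (\<forall>v\<in>pverts G. f (i, v) = g (\<sigma> i, \<pi> v))" if i: "i < m" for i
    proof -
      have "\<sigma> i < m"
        using bij i by (auto dest: bij_betwE)
      then obtain \<pi> where \<pi>: "graph_automorphism G \<pi>"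
        "\<forall>v\<in>pverts G. copy_coloring G f i v = copy_coloring G g (\<sigma> i) (\<pi> v)"
        using class_eq[OF i, of "\<sigma> i"] eq i by blast
      moreover have "\<pi> v \<in> pverts G" if "v \<in> pverts G" for v
        using \<pi>(1) that by (auto simp: graph_automorphism_def dest: bij_betwE)
      ultimately show ?thesis
        by auto
    qed
    then obtain \<pi> where \<pi>: "\<And>i. i < m \<Longrightarrow> graph_automorphism G (\<pi> i)"
      "\<And>i v. i < m \<Longrightarrow> v \<in> pverts G \<Longrightarrow> f (i, v) = g (\<sigma> i, \<pi> i v)"
      by metis
    have "graph_automorphism (disjoint_copies m G) (\<lambda>(i, v). (\<sigma> i, \<pi> i v))"
      by (rule graph_automorphism_disjoint_copiesI[OF bij \<pi>(1)])
    moreover have "\<forall>p\<in>pverts (disjoint_copies m G). f p = g ((\<lambda>(i, v). (\<sigma> i, \<pi> i v)) p)"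
      using \<pi>(2) by (auto simp: disjoint_copies_def)
    ultimately show ?R
      by blast
  }
  assume ?R
  then obtain P where P: "graph_automorphism (disjoint_copies m G) P"
    and fg: "\<And>i v. i < m \<Longrightarrow> v \<in> pverts G \<Longrightarrow> f (i, v) = g (P (i, v))"
    by (auto simp: pverts_disjoint_copies)
  obtain \<sigma> \<pi> where \<sigma>: "bij_betw \<sigma> {..<m} {..<m}"
    and \<pi>: "\<And>i. i < m \<Longrightarrow> graph_automorphism G (\<pi> i)"
    and P_eq: "\<And>i v. i < m \<Longrightarrow> v \<in> pverts G \<Longrightarrow> P (i, v) = (\<sigma> i, \<pi> i v)"
    by (rule graph_automorphism_disjoint_copiesE[OF G conn P]) blast
  have "?cf i = ?cg (\<sigma> i)" if i: "i < m" for i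
  proof -
    have "\<sigma> i < m"
      using \<sigma> i by (auto dest: bij_betwE)
    moreover have "\<pi> i v \<in> pverts G" if "v \<in> pverts G" for v
      using \<pi>[OF i] that by (auto simp: graph_automorphism_def dest: bij_betwE)
    then have "\<forall>v\<in>pverts G. copy_coloring G f i v = copy_coloring G g (\<sigma> i) (\<pi> i v)"
      using fg[OF i] P_eq[OF i] by simp
    ultimately show ?thesis
      using class_eq[OF i] \<pi>[OF i] by blast
  qed
  then have "class_mset m G f = image_mset ?cg (image_mset \<sigma> (mset_set {..<m}))"
    unfolding class_mset_def image_mset.compositionality by (intro image_mset_cong) auto
  also have "image_mset \<sigma> (mset_set {..<m}) = mset_set {..<m}"
    using \<sigma> by (simp add: image_mset_mset_set bij_betw_def)
  finally show "class_mset m G f = class_mset m G g"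
    by (simp add: class_mset_def)
qed

text \<open>
  The colorings of the copies can be chosen independently, so every choice of one class per copy is
  realized. Connectedness enters through \<open>class_mset_eq_iff\<close>: the components of a disconnected
  \<open>G\<close> could be exchanged between copies, which need not preserve the classes on the copies.
\<close>

lemma unlabeled_list_count_disjoint_copies:
  assumes G: "pair_graph G" and conn: "connected (with_proj G)"
  shows "unlabeled_list_count (disjoint_copies m G) L =
    card (transversal_msets m (\<lambda>i. coloring_class G ` list_colorings G (\<lambda>v. L (i, v))))"
    (is "_ = card (transversal_msets m ?X)")
proof -
  have "class_mset m G ` list_colorings (disjoint_copies m G) L = transversal_msets m ?X"
  proof (intro equalityI subsetI)
    fix M assume "M \<in> class_mset m G ` list_colorings (disjoint_copies m G) L"
    then show "M \<in> transversal_msets m ?X"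
      by (auto simp: class_mset_def intro!: transversal_msetsI imageI copy_coloring_mem[OF G])
  next
    fix M assume "M \<in> transversal_msets m ?X"
    then obtain c where M: "M = image_mset c (mset_set {..<m})"
      and c: "\<And>i. i < m \<Longrightarrow> c i \<in> ?X i"
      by (rule transversal_msetsE) blast
    from c have "\<exists>h. h \<in> list_colorings G (\<lambda>v. L (i, v)) \<and> c i = coloring_class G h" if "i < m" for i
      using that by blast
    then obtain h where h: "\<And>i. i < m \<Longrightarrow> h i \<in> list_colorings G (\<lambda>v. L (i, v))"
      "\<And>i. i < m \<Longrightarrow> c i = coloring_class G (h i)"
      by metis
    obtain f where f: "f \<in> list_colorings (disjoint_copies m G) L"
      "\<And>i. i < m \<Longrightarrow> copy_coloring G f i = h i"
      using ex_copy_colorings[OF G, of m h L] h(1) by blast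
    have "M = class_mset m G f"
      unfolding M class_mset_def by (rule image_mset_cong) (simp add: h(2) f(2))
    then show "M \<in> class_mset m G ` list_colorings (disjoint_copies m G) L"
      using f(1) by blast
  qed
  moreover have "unlabeled_list_count (disjoint_copies m G) L =
      card (class_mset m G ` list_colorings (disjoint_copies m G) L)"
    by (rule unlabeled_list_count_eq_card_invariant) (rule class_mset_eq_iff[OF G conn])
  ultimately show ?thesis
    by simp
qed

section \<open>The unlabeled list color function of disjoint copies\<close>

lemma unlabeled_list_color_function_le:
  "k_assignment G k L \<Longrightarrow> unlabeled_list_color_function G k \<le> unlabeled_list_count G L"
  unfolding unlabeled_list_color_function_def by (rule Least_le) blast

lemma unlabeled_list_count_disjoint_copies_ge:
  assumes G: "pair_graph G" and conn: "connected (with_proj G)"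
    and L: "k_assignment (disjoint_copies m G) k L"
  shows "(unlabeled_list_color_function G k + m - 1) choose m
    \<le> unlabeled_list_count (disjoint_copies m G) L"
  unfolding unlabeled_list_count_disjoint_copies[OF G conn]
proof (rule card_transversal_msets_ge)
  interpret pair_graph G by fact
  fix i assume i: "i < m"
  have Li: "k_assignment G k (\<lambda>v. L (i, v))"
    using L i by (auto simp: k_assignment_def pverts_disjoint_copies)
  show "finite (coloring_class G ` list_colorings G (\<lambda>v. L (i, v)))"
    by (rule finite_imageI[OF finite_list_colorings[OF _ Li]]) simp
  show "unlabeled_list_color_function G k \<le>
      card (coloring_class G ` list_colorings G (\<lambda>v. L (i, v)))"
    using unlabeled_list_color_function_le[OF Li]
    by (simp add: unlabeled_list_count_eq_card_classes)
qed

lemma unlabeled_chromatic_disjoint_copies_le: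
  assumes G: "pair_graph G" and conn: "connected (with_proj G)"
  shows "unlabeled_chromatic (disjoint_copies m G) k \<le> (unlabeled_chromatic G k + m - 1) choose m"
proof -
  interpret pair_graph G by fact
  have "finite (coloring_class G ` list_colorings G (\<lambda>_. {1..k}))"
    by (rule finite_imageI[OF finite_list_colorings[OF _ k_assignment_const]]) simp
  then show ?thesis
    unfolding unlabeled_chromatic_def unlabeled_list_count_disjoint_copies[OF G conn]
      unlabeled_list_count_eq_card_classes[of G]
    by (rule card_transversal_msets_const_le)
qed

theorem corollary1p6:
  fixes G :: "'a pair_pre_digraph" and N :: nat
  assumes "pair_graph G"
    and "connected (with_proj G)"
    and "N > 0"
    and "\<And>k. k \<ge> N \<Longrightarrow> unlabeled_list_color_function G k = unlabeled_chromatic G k"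
  shows "\<forall>m>0. \<forall>k\<ge>N. unlabeled_list_color_function (disjoint_copies m G) k =
           unlabeled_chromatic (disjoint_copies m G) k"
proof (intro allI impI)
  fix m k :: nat assume "m > 0" and k: "k \<ge> N"
  let ?H = "disjoint_copies m G"
  obtain L where L: "k_assignment ?H k L"
    "unlabeled_list_color_function ?H k = unlabeled_list_count ?H L"
    using unlabeled_list_color_function_attained by blast
  have "unlabeled_chromatic ?H k \<le> (unlabeled_chromatic G k + m - 1) choose m"
    by (rule unlabeled_chromatic_disjoint_copies_le) fact+
  also have "\<dots> = (unlabeled_list_color_function G k + m - 1) choose m"
    using assms(4)[OF k] by simp
  also have "\<dots> \<le> unlabeled_list_color_function ?H k"
    unfolding L(2) by (rule unlabeled_list_count_disjoint_copies_ge[OF assms(1,2) L(1)])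
  finally have "unlabeled_chromatic ?H k \<le> unlabeled_list_color_function ?H k" .
  moreover have "unlabeled_list_color_function ?H k \<le> unlabeled_chromatic ?H k"
    unfolding unlabeled_chromatic_def
    by (rule unlabeled_list_color_function_le) (rule k_assignment_const)
  ultimately show "unlabeled_list_color_function ?H k = unlabeled_chromatic ?H k"
    by simp
qed

end
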